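(* Let $M$ be a real $n\times n$ $Z$-matrix. The following conditions are equivalent: (1) $M$ is an almost non-singular $M$-matrix; (2) $M+D$ is a non-singular $M$-matrix for every real diagonal matrix $D$ with $D\gneq 0$; (3) $\det(M)\geq 0$, and $\det(M+D)>\det(M+D')>0$ for all real diagonal matrices $D,D'$ with $D\gneq D'\gneq 0$.
   Context: A real square matrix is a $Z$-matrix if all its off-diagonal entries are $\leq 0$. A $Z$-matrix $A$ is an $M$-matrix if $A=\alpha I-B$ for some entrywise non-negative matrix $B$ and real $\alpha\geq\rho(B)$, where $\rho(B)$ is the spectral radius of $B$; a non-singular $M$-matrix is an invertible $M$-matrix. An almost non-singular $M$-matrix is a $Z$-matrix all of whose proper principal minors (determinants of principal submatrices indexed by $I\subsetneq\{1,\dots,n\}$, $I\neq\emptyset$) are positive and whose determinant is non-negative. For real matrices of the same size, $X\geq Y$ means entrywise $\geq$, and $X\gneq Y$ means $X\geq Y$ and $X\neq Y$. *)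

theory Defs
  imports
    "Jordan_Normal_Form.Spectral_Radius"
    "Jordan_Normal_Form.DL_Submatrix"
begin

text \<open>The order \<open>\<le>\<close> on matrices is the library's entrywise order, which also forces equal dimensions.\<close>

abbreviation gneq_mat :: "real mat \<Rightarrow> real mat \<Rightarrow> bool" where
  "gneq_mat X Y \<equiv> X \<ge> Y \<and> X \<noteq> Y"

definition Z_matrix :: "real mat \<Rightarrow> bool" where
  "Z_matrix A \<longleftrightarrow> square_mat A \<and>
     (\<forall>i < dim_row A. \<forall>j < dim_row A. i \<noteq> j \<longrightarrow> A $$ (i, j) \<le> 0)"

text \<open>The spectral radius is taken over all complex eigenvalues.\<close>

definition M_matrix :: "real mat \<Rightarrow> bool" where
  "M_matrix A \<longleftrightarrow> Z_matrix A \<and>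
     (\<exists>\<alpha> B. B \<in> carrier_mat (dim_row A) (dim_row A) \<and>
        B \<ge> 0\<^sub>m (dim_row A) (dim_row A) \<and>
        \<alpha> \<ge> spectral_radius (map_mat complex_of_real B) \<and>
        A = \<alpha> \<cdot>\<^sub>m 1\<^sub>m (dim_row A) - B)"

definition nonsingular_M_matrix :: "real mat \<Rightarrow> bool" where
  "nonsingular_M_matrix A \<longleftrightarrow> M_matrix A \<and> invertible_mat A"

definition almost_nonsingular_M_matrix :: "real mat \<Rightarrow> bool" where
  "almost_nonsingular_M_matrix A \<longleftrightarrow> Z_matrix A \<and>
     (\<forall>I. I \<subset> {0..<dim_row A} \<and> I \<noteq> {} \<longrightarrow> det (submatrix A I I) > 0) \<and>
     det A \<ge> 0"

end

theory Submission
  imports Defs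
begin

text \<open>
  A \<open>Z\<close>-matrix \<open>A\<close> is a non-singular \<open>M\<close>-matrix iff \<open>A x > 0\<close> for some vector \<open>x > 0\<close>, iff
  \<open>det (A + t I) > 0\<close> for all \<open>t \<ge> 0\<close>. The existence of \<open>x\<close> survives replacing rows of \<open>A\<close> by unit
  rows, and the determinants of the resulting matrices are the principal minors. Since \<open>det\<close> is
  affine in each row, \<open>det (M + D)\<close> is a polynomial in the entries of \<open>D\<close> whose coefficients are the
  principal minors of \<open>M\<close>; raising one diagonal entry at a time then gives monotonicity from
  positive minors, and conversely positive minors from strict monotonicity.
\<close>

section \<open>Principal minors as determinants of full-size matrices\<close>

text \<open>\<open>det (keep_rows A I)\<close> is the principal minor of \<open>A\<close> on \<open>I\<close>, obtained without renumbering the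
  indices.\<close>

definition keep_rows :: "real mat \<Rightarrow> nat set \<Rightarrow> real mat" where
  "keep_rows A I = mat (dim_row A) (dim_col A)
     (\<lambda>(i, j). if i \<in> I then A $$ (i, j) else if i = j then 1 else 0)"

lemma keep_rows_carrier [simp]:
  "A \<in> carrier_mat n n \<Longrightarrow> keep_rows A I \<in> carrier_mat n n"
  by (auto simp: keep_rows_def)

lemma keep_rows_index:
  assumes "A \<in> carrier_mat n n" "i < n" "j < n"
  shows "keep_rows A I $$ (i, j) = (if i \<in> I then A $$ (i, j) else if i = j then 1 else 0)"
  using assms by (auto simp: keep_rows_def)

lemma keep_rows_keep_rows:
  assumes "A \<in> carrier_mat n n"
  shows "keep_rows (keep_rows A I) J = keep_rows A (I \<inter> J)"
  by (rule eq_matI) (use assms in \<open>auto simp: keep_rows_def\<close>)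

lemma permutes_less_bound:
  assumes "p permutes {0..<n}" "i < n"
  shows "p i < (n::nat)"
  using permutes_in_image[OF assms(1), of i] assms(2) by simp

text \<open>Conjugation by \<open>f\<close> is a sign-preserving bijection between the permutations
  of \<open>{0..<m}\<close> and those of \<open>I\<close>, so the two Leibniz sums agree term by
  term. This removes the renumbering that \<open>submatrix\<close> introduces.\<close>

lemma det_reindex:
  fixes A :: "real mat"
  assumes bij: "bij_betw f {0..<m} I"
  shows "det (mat m m (\<lambda>(i, j). A $$ (f i, f j)))
    = (\<Sum>p | p permutes I. signof p * (\<Prod>i\<in>I. A $$ (i, p i)))"
proof -
  let ?K = "{0..<m}"
  have inj: "inj_on f ?K" using bij by (rule bij_betw_imp_inj_on)
  have "det (mat m m (\<lambda>(i, j). A $$ (f i, f j)))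
      = (\<Sum>p | p permutes ?K. signof p * (\<Prod>i\<in>?K. A $$ (f i, f (p i))))"
    by (subst det_def'[of _ m])
      (auto intro!: sum.cong prod.cong simp: permutes_less_bound)
  also have "\<dots> = (\<Sum>p | p permutes I. signof p * (\<Prod>i\<in>I. A $$ (i, p i)))"
  proof (rule sum.reindex_bij_witness
      [of _ "map_permutation I (inv_into ?K f)" "map_permutation ?K f"], goal_cases)
    case (1 p)
    then show ?case
      using map_permutation_compose_inv[OF bij, of p "inv_into ?K f"] inj by auto
  next
    case (2 p)
    then show ?case using map_permutation_permutes[OF bij] by auto
  next
    case (3 q)
    then show ?case
      using map_permutation_compose_inv[OF bij_betw_inv_into[OF bij], of q f]
      by (auto simp: bij_betw_inv_into_right[OF bij])
  next
    case (4 q)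
    then show ?case using map_permutation_permutes[OF bij_betw_inv_into[OF bij]] by auto
  next
    case (5 p)
    then have p: "p permutes ?K" by simp
    have "(\<Prod>i\<in>I. A $$ (i, map_permutation ?K f p i)) = (\<Prod>i\<in>?K. A $$ (f i, f (p i)))"
      unfolding prod.reindex_bij_betw[OF bij, symmetric]
      by (intro prod.cong refl) (simp add: map_permutation_apply[OF inj])
    then show ?case by (simp add: sign_map_permutation[OF inj p])
  qed
  finally show ?thesis .
qed

lemma bij_betw_pick:
  assumes "finite I"
  shows "bij_betw (pick I) {0..<card I} I"
proof -
  have "inj_on (pick I) {0..<card I}"
    by (rule linorder_inj_onI) (auto dest: pick_mono_le)
  moreover have "pick I ` {0..<card I} \<subseteq> I"
    by (auto intro: pick_in_set_le)
  ultimately show ?thesis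
    using assms by (simp add: bij_betw_def card_image card_subset_eq)
qed

text \<open>In the Leibniz sum of \<open>keep_rows A I\<close>, a permutation that moves an index
  outside \<open>I\<close> meets a zero of a unit row. The surviving permutations are those of
  \<open>I\<close>, and the unit rows contribute only factors 1.\<close>

lemma det_submatrix_eq_det_keep_rows:
  assumes A: "A \<in> carrier_mat n n" and I: "I \<subseteq> {0..<n}"
  shows "det (submatrix A I I) = det (keep_rows A I)"
proof -
  have fin: "finite I" using I finite_subset by blast
  have "{i. i < n \<and> i \<in> I} = I" using I by auto
  then have "submatrix A I I = mat (card I) (card I) (\<lambda>(i, j). A $$ (pick I i, pick I j))"
    using A by (simp add: submatrix_def)
  then have "det (submatrix A I I) = (\<Sum>p | p permutes I. signof p * (\<Prod>i\<in>I. A $$ (i, p i)))"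
    using det_reindex[OF bij_betw_pick[OF fin]] by simp
  also have "\<dots> = (\<Sum>p | p permutes {0..<n}. signof p * (\<Prod>i\<in>{0..<n}. keep_rows A I $$ (i, p i)))"
  proof (rule sum.mono_neutral_cong_left)
    show "{p. p permutes I} \<subseteq> {p. p permutes {0..<n}}"
      using I by (auto intro: permutes_subset)
    show "\<forall>p\<in>{p. p permutes {0..<n}} - {p. p permutes I}.
      signof p * (\<Prod>i\<in>{0..<n}. keep_rows A I $$ (i, p i)) = 0"
    proof
      fix p assume "p \<in> {p. p permutes {0..<n}} - {p. p permutes I}"
      then have pn: "p permutes {0..<n}" and "\<not> p permutes I" by simp_all
      then obtain i where i: "i \<notin> I" "p i \<noteq> i"
        using permutes_superset[OF pn] by blast
      then have "i < n" using pn by (meson atLeastLessThan_iff permutes_not_in zero_le)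
      moreover have "p i < n" using pn \<open>i < n\<close> by (simp add: permutes_less_bound)
      ultimately have "keep_rows A I $$ (i, p i) = 0"
        using i A by (simp add: keep_rows_index)
      then have "(\<Prod>i\<in>{0..<n}. keep_rows A I $$ (i, p i)) = 0"
        using \<open>i < n\<close> by (intro prod_zero) auto
      then show "signof p * (\<Prod>i\<in>{0..<n}. keep_rows A I $$ (i, p i)) = 0" by simp
    qed
    fix p assume "p \<in> {p. p permutes I}"
    then have p: "p permutes I" by simp
    have "(\<Prod>i\<in>I. A $$ (i, p i)) = (\<Prod>i\<in>{0..<n}. keep_rows A I $$ (i, p i))"
    proof (rule prod.mono_neutral_cong_left)
      show "\<forall>i\<in>{0..<n} - I. keep_rows A I $$ (i, p i) = 1"
        using A p by (auto simp: keep_rows_index permutes_not_in)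
      fix i assume i: "i \<in> I"
      then have "p i \<in> I" using p by (simp add: permutes_in_image)
      then show "A $$ (i, p i) = keep_rows A I $$ (i, p i)"
        using i I A by (subst keep_rows_index[of _ n]) auto
    qed (use I in auto)
    then show "signof p * (\<Prod>i\<in>I. A $$ (i, p i))
      = signof p * (\<Prod>i\<in>{0..<n}. keep_rows A I $$ (i, p i))" by simp
  qed (simp add: finite_permutations)
  also have "\<dots> = det (keep_rows A I)"
    using A by (simp add: det_def'[of _ n])
  finally show ?thesis .
qed

text \<open>Laplace expansion along row \<open>k\<close>: the cofactors of that row do not see its
  entries, so all three matrices share them, and the row of the perturbed matrix is row
  \<open>k\<close> of \<open>A\<close> plus \<open>t\<close> times a unit row. The slope in
  \<open>t\<close> is the principal minor without \<open>k\<close>.\<close>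

lemma det_add_unit_row:
  assumes A: "A \<in> carrier_mat n n" and k: "k < n"
  shows "det (A + mat_diag n (\<lambda>i. if i = k then t else 0)) = det A + t * det (keep_rows A (- {k}))"
proof -
  let ?B = "A + mat_diag n (\<lambda>i. if i = k then t else 0)" and ?C = "keep_rows A (- {k})"
  have B: "?B \<in> carrier_mat n n" using A by (simp add: mat_diag_def)
  have C: "?C \<in> carrier_mat n n" using A by simp
  have cof: "cofactor ?B k j = cofactor A k j" "cofactor ?C k j = cofactor A k j" if "j < n" for j
  proof -
    have "mat_delete ?B k j = mat_delete A k j" "mat_delete ?C k j = mat_delete A k j"
      by (rule eq_matI, use A k that in \<open>auto simp: mat_delete_def mat_diag_def keep_rows_def\<close>)+
    then show "cofactor ?B k j = cofactor A k j" "cofactor ?C k j = cofactor A k j"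
      by (simp_all add: cofactor_def)
  qed
  have "det ?B = (\<Sum>j<n. A $$ (k, j) * cofactor A k j + t * (?C $$ (k, j) * cofactor A k j))"
    unfolding laplace_expansion_row[OF B k]
  proof (rule sum.cong)
    fix j assume "j \<in> {..<n}"
    then have j: "j < n" by simp
    have "?B $$ (k, j) = A $$ (k, j) + t * ?C $$ (k, j)"
      using A k j by (auto simp: mat_diag_def keep_rows_index)
    then show "?B $$ (k, j) * cofactor ?B k j
        = A $$ (k, j) * cofactor A k j + t * (?C $$ (k, j) * cofactor A k j)"
      by (simp only: cof[OF j] distrib_right mult.assoc)
  qed simp
  also have "\<dots> = det A + t * det ?C"
    unfolding laplace_expansion_row[OF A k] laplace_expansion_row[OF C k]
    by (simp add: sum.distrib sum_distrib_left cof)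
  finally show ?thesis .
qed

section \<open>Continuity of determinants and cofactors\<close>

lemma continuous_on_det:
  fixes A :: "'t::topological_space \<Rightarrow> real mat"
  assumes "\<And>t. A t \<in> carrier_mat n n"
    and "\<And>i j. i < n \<Longrightarrow> j < n \<Longrightarrow> continuous_on S (\<lambda>t. A t $$ (i, j))"
  shows "continuous_on S (\<lambda>t. det (A t))"
  unfolding det_def'[OF assms(1)]
  by (intro continuous_intros assms(2)) (auto simp: permutes_less_bound)

lemma continuous_on_cofactor:
  fixes A :: "'t::topological_space \<Rightarrow> real mat"
  assumes A: "\<And>t. A t \<in> carrier_mat n n"
    and "\<And>i j. i < n \<Longrightarrow> j < n \<Longrightarrow> continuous_on S (\<lambda>t. A t $$ (i, j))"
    and "i < n" "j < n"
  shows "continuous_on S (\<lambda>t. cofactor (A t) i j)"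
proof -
  have dims: "dim_row (A t) = n" "dim_col (A t) = n" for t using A[of t] by auto
  have "continuous_on S (\<lambda>t. det (mat_delete (A t) i j))"
  proof (rule continuous_on_det)
    show "mat_delete (A t) i j \<in> carrier_mat (n - 1) (n - 1)" for t
      by (auto simp: mat_delete_def dims)
    fix r s assume "r < n - 1" "s < n - 1"
    then show "continuous_on S (\<lambda>t. mat_delete (A t) i j $$ (r, s))"
      by (auto simp: mat_delete_def dims intro!: assms(2))
  qed
  then show ?thesis unfolding cofactor_def by (intro continuous_intros)
qed

section \<open>Semipositivity and its stability on Z-matrices\<close>

definition semipositive_mat :: "real mat \<Rightarrow> bool" where
  "semipositive_mat A \<longleftrightarrow> (\<exists>x. (\<forall>i<dim_row A. 0 < x i) \<and>
     (\<forall>i<dim_row A. 0 < (\<Sum>j<dim_row A. A $$ (i, j) * x j)))"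

lemma semipositive_matI:
  assumes "A \<in> carrier_mat n n" "\<And>i. i < n \<Longrightarrow> 0 < x i"
    "\<And>i. i < n \<Longrightarrow> 0 < (\<Sum>j<n. A $$ (i, j) * x j)"
  shows "semipositive_mat A"
  using assms unfolding semipositive_mat_def by auto

lemma semipositive_matE:
  assumes "semipositive_mat A" "A \<in> carrier_mat n n"
  obtains x where "\<And>i. i < n \<Longrightarrow> 0 < x i"
    "\<And>i. i < n \<Longrightarrow> 0 < (\<Sum>j<n. A $$ (i, j) * x j)"
  using assms unfolding semipositive_mat_def by auto

lemma Z_matrix_iff:
  assumes "A \<in> carrier_mat n n"
  shows "Z_matrix A \<longleftrightarrow> (\<forall>i<n. \<forall>j<n. i \<noteq> j \<longrightarrow> A $$ (i, j) \<le> 0)"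
  using assms by (auto simp: Z_matrix_def)

text \<open>The same positive \<open>x\<close> serves: a kept row has its old positive value, and
  unit row \<open>i\<close> has the value \<open>x i\<close>.\<close>

lemma semipositive_keep_rows:
  assumes A: "A \<in> carrier_mat n n" and "semipositive_mat A"
  shows "semipositive_mat (keep_rows A I)"
proof -
  obtain x where x: "\<And>i. i < n \<Longrightarrow> 0 < x i"
    "\<And>i. i < n \<Longrightarrow> 0 < (\<Sum>j<n. A $$ (i, j) * x j)"
    using semipositive_matE[OF assms(2) A] by metis
  have "(\<Sum>j<n. keep_rows A I $$ (i, j) * x j)
      = (if i \<in> I then \<Sum>j<n. A $$ (i, j) * x j else x i)" if "i < n" for i
    using that A by (simp add: keep_rows_index if_distrib[of "\<lambda>z. z * _"] cong: if_cong)
  then show ?thesis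
    by (intro semipositive_matI[of _ n x]) (use A x in auto)
qed

lemma Z_matrix_keep_rows:
  assumes "A \<in> carrier_mat n n" "Z_matrix A"
  shows "Z_matrix (keep_rows A I)"
  using assms by (simp add: Z_matrix_iff[of _ n] keep_rows_index)

lemma Z_matrix_add_diag:
  assumes "A \<in> carrier_mat n n" "Z_matrix A"
  shows "Z_matrix (A + mat_diag n d)"
proof -
  have "A + mat_diag n d \<in> carrier_mat n n" by (simp add: mat_diag_def)
  then show ?thesis using assms by (simp add: Z_matrix_iff[of _ n] mat_diag_def)
qed

section \<open>From semipositivity to non-singular M-matrices and positive determinants\<close>

text \<open>In the maximum norm with weights \<open>1 / x i\<close>, the nonnegative matrix
  \<open>B\<close> stretches vectors by a factor below \<alpha>. Applying this to a complex
  eigenvector bounds the eigenvalue.\<close>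

lemma eigenvalue_norm_less_of_positive_vector:
  fixes B :: "real mat"
  assumes B: "B \<in> carrier_mat n n"
    and nonneg: "\<And>i j. i < n \<Longrightarrow> j < n \<Longrightarrow> 0 \<le> B $$ (i, j)"
    and x: "\<And>i. i < n \<Longrightarrow> 0 < x i"
    and Bx: "\<And>i. i < n \<Longrightarrow> (\<Sum>j<n. B $$ (i, j) * x j) < \<alpha> * x i"
    and ev: "eigenvalue (map_mat complex_of_real B) l"
  shows "cmod l < \<alpha>"
proof -
  obtain v where v: "v \<in> carrier_vec n" "v \<noteq> 0\<^sub>v n"
    "map_mat complex_of_real B *\<^sub>v v = l \<cdot>\<^sub>v v"
    using ev B unfolding eigenvalue_def eigenvector_def by auto
  obtain k where k: "k < n" "v $ k \<noteq> 0" using v by (metis eq_vecI carrier_vecD index_zero_vec)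
  \<comment> \<open>At an index \<open>i\<close> maximising \<open>q\<close>, row \<open>i\<close>
    of the eigenvalue equation gives \<open>cmod l * cmod (v $ i)\<close> at most \<open>q i\<close>
    times entry \<open>i\<close> of \<open>B x\<close>, which is less than
    \<open>q i * (\<alpha> * x i) = \<alpha> * cmod (v $ i)\<close>.\<close>
  define q where "q i = cmod (v $ i) / x i" for i
  obtain i where i: "i < n" "\<And>j. j < n \<Longrightarrow> q j \<le> q i"
  proof -
    have "Max (q ` {..<n}) \<in> q ` {..<n}" using k by (intro Max_in) auto
    then obtain i where "i < n" "q i = Max (q ` {..<n})" by auto
    then show ?thesis using that by auto
  qed
  have q: "q i > 0"
  proof -
    have "0 < q k" using k x by (simp add: q_def)
    then show ?thesis using i(2)[OF k(1)] by simp
  qed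
  have vx: "cmod (v $ j) = q j * x j" if "j < n" for j using x[OF that] by (simp add: q_def)
  have "l * v $ i = (map_mat complex_of_real B *\<^sub>v v) $ i"
    using v i by simp
  also have "\<dots> = (\<Sum>j<n. complex_of_real (B $$ (i, j)) * v $ j)"
    using v(1) i(1) B by (simp add: scalar_prod_def lessThan_atLeast0)
  finally have "cmod l * cmod (v $ i) = cmod (\<Sum>j<n. complex_of_real (B $$ (i, j)) * v $ j)"
    by (metis norm_mult)
  also have "\<dots> \<le> (\<Sum>j<n. cmod (complex_of_real (B $$ (i, j)) * v $ j))"
    by (rule norm_sum)
  also have "\<dots> \<le> (\<Sum>j<n. q i * (B $$ (i, j) * x j))"
  proof (rule sum_mono)
    fix j assume "j \<in> {..<n}"
    then have j: "j < n" by simp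
    have "cmod (complex_of_real (B $$ (i, j)) * v $ j) = B $$ (i, j) * x j * q j"
      using nonneg[OF i(1) j] by (simp add: norm_mult vx[OF j])
    also have "\<dots> \<le> B $$ (i, j) * x j * q i"
      using nonneg[OF i(1) j] x[OF j] i(2)[OF j] by (intro mult_left_mono) auto
    finally show "cmod (complex_of_real (B $$ (i, j)) * v $ j) \<le> q i * (B $$ (i, j) * x j)"
      by (simp add: mult.commute)
  qed
  also have "\<dots> = q i * (\<Sum>j<n. B $$ (i, j) * x j)" by (simp add: sum_distrib_left)
  also have "\<dots> < q i * (\<alpha> * x i)" using Bx[OF i(1)] q by simp
  also have "\<dots> = \<alpha> * cmod (v $ i)" by (simp add: vx[OF i(1)])
  finally have "cmod l * cmod (v $ i) < \<alpha> * cmod (v $ i)" .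
  then show ?thesis by (simp add: mult_less_cancel_right)
qed

lemma eigenvalue_of_real_if_det_eq_0:
  fixes B :: "real mat"
  assumes B: "B \<in> carrier_mat n n" and "det (b \<cdot>\<^sub>m 1\<^sub>m n - B) = 0"
  shows "eigenvalue (map_mat complex_of_real B) (complex_of_real b)"
proof -
  have "char_matrix B b = (-1) \<cdot>\<^sub>m (b \<cdot>\<^sub>m 1\<^sub>m n - B)"
    using B by (intro eq_matI) (auto simp: char_matrix_def)
  then have "det (char_matrix B b) = 0" using assms(2) by simp
  then have "eigenvalue B b" using eigenvalue_det[OF B] by simp
  then show ?thesis by (rule of_real_hom.eigenvalue_hom[OF B])
qed

lemma invertible_mat_iff_det:
  fixes A :: "real mat"
  assumes A: "A \<in> carrier_mat n n"
  shows "invertible_mat A \<longleftrightarrow> det A \<noteq> 0"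
proof
  assume "invertible_mat A"
  then obtain B where B: "A * B = 1\<^sub>m n" "B * A = 1\<^sub>m (dim_row B)"
    using A by (auto simp: invertible_mat_def inverts_mat_def)
  have "B \<in> carrier_mat n n"
    using arg_cong[OF B(1), of dim_col] arg_cong[OF B(2), of dim_col] A by auto
  then have "det A * det B = 1" using det_mult[OF A] B(1) by (metis det_one)
  then show "det A \<noteq> 0" by auto
next
  assume d: "det A \<noteq> 0"
  have adj: "adj_mat A \<in> carrier_mat n n" using adj_mat(1)[OF A] .
  let ?B = "inverse (det A) \<cdot>\<^sub>m adj_mat A"
  have "A * ?B = 1\<^sub>m n"
    using mult_smult_distrib[OF A adj] adj_mat(2)[OF A] d by (auto intro!: eq_matI)
  moreover have "?B * A = 1\<^sub>m n"
    using mult_smult_assoc_mat[OF adj A] adj_mat(3)[OF A] d by (auto intro!: eq_matI)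
  ultimately show "invertible_mat A"
    unfolding invertible_mat_def inverts_mat_def using A adj by auto
qed

text \<open>Once \<alpha> dominates the diagonal of \<open>A\<close>, the matrix
  \<open>\<alpha> I - A\<close> is nonnegative, and \<open>A x > 0\<close> becomes
  \<open>B x < \<alpha> x\<close>, the hypothesis of the eigenvalue bound.\<close>

lemma semipositive_Z_matrix_splitting:
  assumes A: "A \<in> carrier_mat n n" and Z: "Z_matrix A" and sp: "semipositive_mat A"
  obtains \<alpha> B where "B \<in> carrier_mat n n" "B \<ge> 0\<^sub>m n n" "A = \<alpha> \<cdot>\<^sub>m 1\<^sub>m n - B" "\<alpha> \<ge> 0"
    "\<And>l. eigenvalue (map_mat complex_of_real B) l \<Longrightarrow> cmod l < \<alpha>"
proof -
  obtain x where x: "\<And>i. i < n \<Longrightarrow> 0 < x i"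
    "\<And>i. i < n \<Longrightarrow> 0 < (\<Sum>j<n. A $$ (i, j) * x j)"
    using semipositive_matE[OF sp A] by metis
  \<comment> \<open>Any common upper bound of the diagonal entries makes \<open>B\<close>
    nonnegative; the sum of absolute values is one that is also nonnegative itself.\<close>
  define \<alpha> where "\<alpha> = (\<Sum>i<n. \<bar>A $$ (i, i)\<bar>)"
  define B where "B = \<alpha> \<cdot>\<^sub>m 1\<^sub>m n - A"
  have B: "B \<in> carrier_mat n n" using A by (auto simp: B_def)
  have entry: "B $$ (i, j) = (if i = j then \<alpha> else 0) - A $$ (i, j)" if "i < n" "j < n" for i j
    using A that by (simp add: B_def)
  have "A $$ (i, i) \<le> \<alpha>" if "i < n" for i
  proof -
    have "\<bar>A $$ (i, i)\<bar> \<le> \<alpha>" unfolding \<alpha>_def using that by (intro member_le_sum) auto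
    then show ?thesis by simp
  qed
  then have nonneg: "0 \<le> B $$ (i, j)" if "i < n" "j < n" for i j
    using that Z entry[OF that] by (auto simp: Z_matrix_iff[OF A])
  show ?thesis
  proof (rule that[OF B])
    show "B \<ge> 0\<^sub>m n n" using B nonneg by (auto simp: less_eq_mat_def)
    show "A = \<alpha> \<cdot>\<^sub>m 1\<^sub>m n - B" using A by (intro eq_matI) (auto simp: B_def)
    show "\<alpha> \<ge> 0" by (simp add: \<alpha>_def sum_nonneg)
    fix l assume ev: "eigenvalue (map_mat complex_of_real B) l"
    have "(\<Sum>j<n. B $$ (i, j) * x j) < \<alpha> * x i" if i: "i < n" for i
    proof -
      have "(\<Sum>j<n. B $$ (i, j) * x j)
          = (\<Sum>j<n. (if i = j then \<alpha> * x j else 0) - A $$ (i, j) * x j)"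
        by (rule sum.cong) (auto simp: entry i algebra_simps)
      also have "\<dots> = \<alpha> * x i - (\<Sum>j<n. A $$ (i, j) * x j)"
        using i by (simp add: sum_subtractf)
      finally show ?thesis using x(2)[OF i] by simp
    qed
    then show "cmod l < \<alpha>"
      using nonneg x(1) by (intro eigenvalue_norm_less_of_positive_vector[OF B _ _ _ ev, of x])
  qed
qed

text \<open>A vanishing determinant would make \<alpha> an eigenvalue of \<open>B\<close>, although
  all eigenvalues have modulus strictly below \<alpha>.\<close>

lemma det_semipositive_neq_0:
  assumes A: "A \<in> carrier_mat n n" and "Z_matrix A" "semipositive_mat A"
  shows "det A \<noteq> 0"
proof
  assume d: "det A = 0"
  obtain \<alpha> B where B: "B \<in> carrier_mat n n" "A = \<alpha> \<cdot>\<^sub>m 1\<^sub>m n - B" "\<alpha> \<ge> 0"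
    "\<And>l. eigenvalue (map_mat complex_of_real B) l \<Longrightarrow> cmod l < \<alpha>"
    using semipositive_Z_matrix_splitting[OF assms] by metis
  have "cmod (complex_of_real \<alpha>) < \<alpha>"
    using B(4)[OF eigenvalue_of_real_if_det_eq_0[OF B(1)]] d B(2) by simp
  then show False using B(3) by simp
qed

lemma semipositive_imp_nonsingular_M_matrix:
  assumes A: "A \<in> carrier_mat n n" and Z: "Z_matrix A" and sp: "semipositive_mat A" and "n > 0"
  shows "nonsingular_M_matrix A"
proof -
  obtain \<alpha> B where B: "B \<in> carrier_mat n n" "B \<ge> 0\<^sub>m n n" "A = \<alpha> \<cdot>\<^sub>m 1\<^sub>m n - B"
    "\<And>l. eigenvalue (map_mat complex_of_real B) l \<Longrightarrow> cmod l < \<alpha>"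
    using semipositive_Z_matrix_splitting[OF A Z sp] by metis
  \<comment> \<open>Since \<open>n > 0\<close>, the spectrum is nonempty and the spectral radius is
    attained at an eigenvalue.\<close>
  have "spectral_radius (map_mat complex_of_real B)
      \<in> norm ` spectrum (map_mat complex_of_real B)"
    using spectral_radius_mem_max(1)[of "map_mat complex_of_real B" n] B(1) \<open>n > 0\<close> by simp
  then have "spectral_radius (map_mat complex_of_real B) \<le> \<alpha>"
    using B(4) by (auto simp: spectrum_def less_imp_le)
  then show ?thesis
    using A Z B det_semipositive_neq_0[OF A Z sp] invertible_mat_iff_det[OF A]
    by (auto simp: nonsingular_M_matrix_def M_matrix_def)
qed

text \<open>Along the segment from the identity to \<open>A\<close> the determinant starts at 1 and
  is continuous; as it never vanishes, it cannot change sign.\<close>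

lemma det_pos_if_homotopy:
  fixes A :: "real mat"
  assumes A: "A \<in> carrier_mat n n"
    and nz: "\<And>s. 0 < s \<Longrightarrow> s \<le> 1 \<Longrightarrow> det (s \<cdot>\<^sub>m A + (1 - s) \<cdot>\<^sub>m 1\<^sub>m n) \<noteq> 0"
  shows "det A > 0"
proof (rule ccontr)
  let ?f = "\<lambda>s. det (s \<cdot>\<^sub>m A + (1 - s) \<cdot>\<^sub>m 1\<^sub>m n)"
  assume neg: "\<not> det A > 0"
  have "1 \<cdot>\<^sub>m A + (1 - 1) \<cdot>\<^sub>m 1\<^sub>m n = A" "0 \<cdot>\<^sub>m A + (1 - 0) \<cdot>\<^sub>m 1\<^sub>m n = 1\<^sub>m n"
    using A by (auto intro!: eq_matI)
  then have f: "?f 1 = det A" "?f 0 = 1" by simp_all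
  have "continuous_on {0..1} ?f"
    by (rule continuous_on_det[of _ n]) (use A in \<open>auto intro!: continuous_intros\<close>)
  then obtain s where "0 \<le> s" "s \<le> 1" "?f s = 0"
    using IVT2'[of ?f 1 0 0] f neg by auto
  then show False using nz[of s] f(2) by (cases "s = 0") auto
qed

text \<open>Every point of the segment from the identity to \<open>A\<close> is again a Z-matrix,
  semipositive with the same \<open>x\<close>, hence has nonzero determinant.\<close>

lemma det_semipositive_pos:
  assumes A: "A \<in> carrier_mat n n" and Z: "Z_matrix A" and sp: "semipositive_mat A"
  shows "det A > 0"
proof (rule det_pos_if_homotopy[OF A])
  fix s :: real assume s: "0 < s" "s \<le> 1"
  let ?H = "s \<cdot>\<^sub>m A + (1 - s) \<cdot>\<^sub>m 1\<^sub>m n"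
  obtain x where x: "\<And>i. i < n \<Longrightarrow> 0 < x i"
    "\<And>i. i < n \<Longrightarrow> 0 < (\<Sum>j<n. A $$ (i, j) * x j)"
    using semipositive_matE[OF sp A] by metis
  have H: "?H \<in> carrier_mat n n" using A by simp
  have entry: "?H $$ (i, j) = s * A $$ (i, j) + (if i = j then 1 - s else 0)"
    if "i < n" "j < n" for i j
    using A that by simp
  have "Z_matrix ?H"
    unfolding Z_matrix_iff[OF H] using Z s
    by (auto simp: entry Z_matrix_iff[OF A] mult_le_0_iff simp del: index_add_mat)
  moreover have "semipositive_mat ?H"
  proof (rule semipositive_matI[OF H x(1)])
    fix i assume i: "i < n"
    have "(\<Sum>j<n. ?H $$ (i, j) * x j)
        = (\<Sum>j<n. s * (A $$ (i, j) * x j) + (if i = j then (1 - s) * x j else 0))"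
      by (rule sum.cong) (auto simp: entry i algebra_simps simp del: index_add_mat)
    also have "\<dots> = s * (\<Sum>j<n. A $$ (i, j) * x j) + (1 - s) * x i"
      using i by (simp add: sum.distrib sum_distrib_left)
    also have "\<dots> > 0" using x[OF i] s by (intro add_pos_nonneg) auto
    finally show "0 < (\<Sum>j<n. ?H $$ (i, j) * x j)" .
  qed
  ultimately show "det ?H \<noteq> 0" by (rule det_semipositive_neq_0[OF H])
qed

section \<open>From non-singular M-matrices back to semipositivity\<close>

text \<open>No real \<open>b\<close> with \<open>b \<ge> \<alpha>\<close> is an eigenvalue of
  \<open>B\<close>: above \<alpha> it would exceed the spectral radius, and \<alpha> itself is
  excluded by invertibility of \<open>A\<close>. Up to a positive scalar, every point with
  \<open>s > 0\<close> on the segment from the identity to \<open>A + t I\<close> is such a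
  \<open>b I - B\<close>.\<close>

lemma nonsingular_M_matrix_det_add_scalar_pos:
  assumes A: "A \<in> carrier_mat n n" and M: "nonsingular_M_matrix A" and "n > 0" and t: "t \<ge> 0"
  shows "det (A + mat_diag n (\<lambda>_. t)) > 0"
proof -
  obtain \<alpha> B where B: "B \<in> carrier_mat n n" "A = \<alpha> \<cdot>\<^sub>m 1\<^sub>m n - B"
    and rad: "spectral_radius (map_mat complex_of_real B) \<le> \<alpha>"
    using M A by (auto simp: nonsingular_M_matrix_def M_matrix_def)
  have det_neq_0: "det (b \<cdot>\<^sub>m 1\<^sub>m n - B) \<noteq> 0" if "b \<ge> \<alpha>" for b
  proof
    assume *: "det (b \<cdot>\<^sub>m 1\<^sub>m n - B) = 0"
    have "b \<noteq> \<alpha>"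
      using * M B(2) invertible_mat_iff_det[OF A] by (auto simp: nonsingular_M_matrix_def)
    moreover have "complex_of_real b \<in> spectrum (map_mat complex_of_real B)"
      using eigenvalue_of_real_if_det_eq_0[OF B(1) *] by (simp add: spectrum_def)
    then have "cmod (complex_of_real b) \<le> spectral_radius (map_mat complex_of_real B)"
      using B(1) \<open>n > 0\<close> by (intro spectral_radius_mem_max(2)[of _ n] imageI) auto
    ultimately show False using rad that by simp
  qed
  show ?thesis
  proof (rule det_pos_if_homotopy[of _ n])
    fix s :: real assume s: "0 < s" "s \<le> 1"
    \<comment> \<open>Dividing the segment point by \<open>s\<close> turns the identity part
      \<open>1 - s\<close> into \<open>(1 - s) / s\<close>.\<close>
    let ?b = "\<alpha> + t + (1 - s) / s"
    have "s \<cdot>\<^sub>m (A + mat_diag n (\<lambda>_. t)) + (1 - s) \<cdot>\<^sub>m 1\<^sub>m n = s \<cdot>\<^sub>m (?b \<cdot>\<^sub>m 1\<^sub>m n - B)"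
      using B s by (intro eq_matI) (auto simp: mat_diag_def field_simps)
    moreover have "det (?b \<cdot>\<^sub>m 1\<^sub>m n - B) \<noteq> 0" using s t by (intro det_neq_0) simp
    ultimately show "det (s \<cdot>\<^sub>m (A + mat_diag n (\<lambda>_. t)) + (1 - s) \<cdot>\<^sub>m 1\<^sub>m n) \<noteq> 0"
      using s by simp
  qed (use A in \<open>simp add: mat_diag_def\<close>)
qed

text \<open>The vector \<open>y t = adj (A + t I) 1\<close> satisfies \<open>(A + t I) (y t) = det (A + t I) 1\<close>. The sign
  pattern of \<open>A\<close> prevents a nonnegative \<open>y t\<close> from having a zero entry, so positivity of \<open>y\<close>
  propagates from large \<open>t\<close> down to \<open>t = 0\<close>.\<close>

lemma semipositive_if_det_add_scalar_pos:
  assumes A: "A \<in> carrier_mat n n" and Z: "Z_matrix A"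
    and pos: "\<And>t. t \<ge> 0 \<Longrightarrow> det (A + mat_diag n (\<lambda>_. t)) > 0"
  shows "semipositive_mat A"
proof -
  define C where "C t = A + mat_diag n (\<lambda>_. t)" for t
  have C: "C t \<in> carrier_mat n n" for t by (simp add: C_def mat_diag_def)
  have entry: "C t $$ (i, j) = A $$ (i, j) + (if i = j then t else 0)" if "i < n" "j < n" for t i j
    using that A by (simp add: C_def mat_diag_def)
  have off: "C t $$ (i, j) \<le> 0" if "i < n" "j < n" "i \<noteq> j" for t i j
    using that Z by (simp add: entry Z_matrix_iff[OF A])
  have det_pos: "det (C t) > 0" if "t \<ge> 0" for t using pos[OF that] by (simp add: C_def)
  define y where "y t k = (\<Sum>j<n. cofactor (C t) j k)" for t k
  have cont_diag: "continuous_on S (\<lambda>t. if b then t else 0)" for b and S :: "real set"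
    by (cases b) (auto intro: continuous_intros)
  have cont: "continuous_on S (\<lambda>t. y t k)" if "k < n" for k and S :: "real set"
    unfolding y_def using that
    by (intro continuous_on_sum continuous_on_cofactor[of _ n] C)
      (auto simp: entry intro!: continuous_intros cont_diag)
  have Cy: "(\<Sum>k<n. C t $$ (i, k) * y t k) = det (C t)" if i: "i < n" for t i
  proof -
    have "(\<Sum>k<n. C t $$ (i, k) * cofactor (C t) j k) = (if i = j then det (C t) else 0)"
      if j: "j < n" for j
    proof -
      have "(\<Sum>k<n. C t $$ (i, k) * cofactor (C t) j k) = (C t * adj_mat (C t)) $$ (i, j)"
        using i j C[of t] adj_mat(1)[OF C[of t]]
        by (auto simp: scalar_prod_def adj_mat_def lessThan_atLeast0)
      then show ?thesis using i j by (simp add: adj_mat(2)[OF C])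
    qed
    then have "(\<Sum>j<n. \<Sum>k<n. C t $$ (i, k) * cofactor (C t) j k) = det (C t)"
      using i by simp
    then show ?thesis
      unfolding y_def sum_distrib_left by (subst sum.swap)
  qed
  have strict: "y t i > 0" if t: "t \<ge> 0" and nonneg: "\<And>j. j < n \<Longrightarrow> y t j \<ge> 0" and i: "i < n" for t i
  proof (rule ccontr)
    assume "\<not> y t i > 0"
    then have "y t i = 0" using nonneg[OF i] by simp
    \<comment> \<open>The diagonal term vanishes with \<open>y t i\<close>, and every other term is
      a nonpositive entry times a nonnegative one; but the sum equals the positive
      determinant.\<close>
    have "(\<Sum>k<n. C t $$ (i, k) * y t k) \<le> 0"
    proof (rule sum_nonpos)
      fix k assume "k \<in> {..<n}"
      then show "C t $$ (i, k) * y t k \<le> 0"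
        using \<open>y t i = 0\<close> off[of i k t] nonneg[of k] i by (cases "k = i") (auto simp: mult_le_0_iff)
    qed
    then show False using Cy[OF i] det_pos[OF t] by simp
  qed
  \<comment> \<open>With this shift every row sum of \<open>C T\<close> is at least 1.\<close>
  define T where "T = (\<Sum>i<n. \<bar>\<Sum>j<n. A $$ (i, j)\<bar>) + 1"
  have T: "T \<ge> 0" by (simp add: T_def sum_nonneg)
  have large: "y T j \<ge> 0" if j: "j < n" for j
  proof -
    obtain i where i: "i < n" "\<And>j. j < n \<Longrightarrow> y T i \<le> y T j"
    proof -
      have "Min (y T ` {..<n}) \<in> y T ` {..<n}" using j by (intro Min_in) auto
      then obtain i where "i < n" "y T i = Min (y T ` {..<n})" by auto
      then show ?thesis using that by auto
    qed
    have "\<bar>\<Sum>j<n. A $$ (i, j)\<bar> \<le> T - 1"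
      unfolding T_def using i(1) member_le_sum[of i "{..<n}" "\<lambda>i. \<bar>\<Sum>j<n. A $$ (i, j)\<bar>"] by simp
    moreover have "(\<Sum>k<n. C T $$ (i, k)) = (\<Sum>k<n. A $$ (i, k)) + T"
      using i(1) by (simp add: entry sum.distrib)
    ultimately have row: "(\<Sum>k<n. C T $$ (i, k)) > 0" by linarith
    have "0 < (\<Sum>k<n. C T $$ (i, k) * y T k)" using Cy[OF i(1)] det_pos[OF T] by simp
    \<comment> \<open>As \<open>y T i\<close> is the minimum and off-diagonal entries are
      nonpositive, replacing each \<open>y T k\<close> by it can only increase the sum.\<close>
    also have "\<dots> \<le> (\<Sum>k<n. C T $$ (i, k) * y T i)"
    proof (rule sum_mono)
      fix k assume "k \<in> {..<n}"
      then show "C T $$ (i, k) * y T k \<le> C T $$ (i, k) * y T i"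
        using off[of i k T] i by (cases "k = i") (auto intro: mult_left_mono_neg)
    qed
    also have "\<dots> = (\<Sum>k<n. C T $$ (i, k)) * y T i" by (simp add: sum_distrib_right)
    finally have "y T i > 0" using row by (simp add: zero_less_mult_iff)
    then show ?thesis using i(2)[OF j] by simp
  qed
  \<comment> \<open>On \<open>{0..T}\<close> the closed sets \<open>P\<close> (all entries
    nonnegative) and \<open>Q\<close> (some entry nonpositive) form a cover, and
    \<open>strict\<close> makes them disjoint. By connectedness one of them misses the interval; it
    is \<open>Q\<close>, because \<open>T\<close> lies in \<open>P\<close>.\<close>
  define P where "P = (\<Inter>k\<in>{..<n}. {t. 0 \<le> y t k})"
  define Q where "Q = (\<Union>k\<in>{..<n}. {t. y t k \<le> 0})"
  have "closed P" unfolding P_def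
    by (intro closed_INT ballI closed_Collect_le continuous_on_const cont) auto
  moreover have "closed Q" unfolding Q_def
    by (intro closed_UN ballI closed_Collect_le continuous_on_const cont) auto
  moreover have "P \<inter> Q \<inter> {0..T} = {}"
    using strict by (fastforce simp: P_def Q_def)
  moreover have "{0..T} \<subseteq> P \<union> Q" by (auto simp: P_def Q_def)
  moreover have "P \<inter> {0..T} \<noteq> {}"
  proof -
    have "T \<in> P \<inter> {0..T}" using large T by (simp add: P_def)
    then show ?thesis by blast
  qed
  ultimately have "Q \<inter> {0..T} = {}"
    using connected_closedD[OF connected_Icc, of P Q 0 T] by blast
  then have "y 0 k > 0" if "k < n" for k
    using that T by (force simp: Q_def)
  moreover have "C 0 = A" using A by (intro eq_matI) (auto simp: C_def mat_diag_def)
  ultimately show ?thesis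
    using Cy[of _ 0] det_pos[of 0] by (intro semipositive_matI[OF A, of "y 0"]) auto
qed

lemma nonsingular_M_matrix_imp_semipositive:
  assumes "A \<in> carrier_mat n n" "Z_matrix A" "nonsingular_M_matrix A" "n > 0"
  shows "semipositive_mat A"
  using semipositive_if_det_add_scalar_pos[OF assms(1,2)]
    nonsingular_M_matrix_det_add_scalar_pos[OF assms(1,3,4)] by blast

section \<open>Principal minors under diagonal increments\<close>

lemma add_mat_diag_mat_diag:
  fixes A :: "real mat"
  assumes "A \<in> carrier_mat n n"
  shows "A + mat_diag n d + mat_diag n e = A + mat_diag n (\<lambda>i. d i + e i)"
  by (rule eq_matI) (use assms in \<open>auto simp: mat_diag_def\<close>)

lemma add_mat_diag_carrier [simp]: "A + mat_diag n d \<in> carrier_mat n n"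
  by (simp add: mat_diag_def)

lemma keep_rows_add_unit_row_notin:
  assumes "A \<in> carrier_mat n n" "k \<notin> I"
  shows "keep_rows (A + mat_diag n (\<lambda>i. if i = k then t else 0)) I = keep_rows A I"
  by (rule eq_matI) (use assms in \<open>auto simp: keep_rows_def mat_diag_def\<close>)

lemma keep_rows_add_unit_row_in:
  assumes "A \<in> carrier_mat n n" "k \<in> I"
  shows "keep_rows (A + mat_diag n (\<lambda>i. if i = k then t else 0)) I
    = keep_rows A I + mat_diag n (\<lambda>i. if i = k then t else 0)"
  by (rule eq_matI) (use assms in \<open>auto simp: keep_rows_def mat_diag_def\<close>)

definition almost_P_mat :: "nat \<Rightarrow> real mat \<Rightarrow> bool" where
  "almost_P_mat n A \<longleftrightarrow> det A \<ge> 0 \<and> (\<forall>I. I \<subset> {0..<n} \<longrightarrow> det (keep_rows A I) > 0)"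

lemma almost_nonsingular_M_matrix_iff:
  assumes A: "A \<in> carrier_mat n n" and Z: "Z_matrix A"
  shows "almost_nonsingular_M_matrix A \<longleftrightarrow> almost_P_mat n A"
proof -
  have "keep_rows A {} = 1\<^sub>m n" using A by (intro eq_matI) (auto simp: keep_rows_def)
  then have "det (keep_rows A {}) > 0" by simp
  then show ?thesis
    using A Z det_submatrix_eq_det_keep_rows[OF A]
    unfolding almost_nonsingular_M_matrix_def almost_P_mat_def
    by (metis carrier_matD(1) psubset_imp_subset)
qed

text \<open>A minor on \<open>I\<close> is unchanged if \<open>k\<close> is outside
  \<open>I\<close>; otherwise it grows by \<open>t\<close> times the minor on \<open>I\<close>
  without \<open>k\<close>, which is positive. The full determinant follows the same rule.\<close>

lemma almost_P_mat_add_unit_row: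
  assumes A: "A \<in> carrier_mat n n" and P: "almost_P_mat n A" and k: "k < n" and t: "t \<ge> 0"
  defines "A' \<equiv> A + mat_diag n (\<lambda>i. if i = k then t else 0)"
  shows "almost_P_mat n A'" "t > 0 \<Longrightarrow> det A < det A'" "det A \<le> det A'"
proof -
  have pos: "det (keep_rows A I) > 0" if "I \<subset> {0..<n}" for I
    using P that by (simp add: almost_P_mat_def)
  have "keep_rows A (- {k}) = keep_rows A ({0..<n} - {k})"
    using A by (intro eq_matI) (auto simp: keep_rows_def)
  then have eq: "det A' = det A + t * det (keep_rows A ({0..<n} - {k}))"
    unfolding A'_def det_add_unit_row[OF A k] by simp
  have "k \<in> {0..<n}" using k by simp
  then have c: "det (keep_rows A ({0..<n} - {k})) > 0" by (intro pos) blast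
  show le: "det A \<le> det A'" using eq c t by simp
  show "det A < det A'" if "t > 0" using eq c that by simp
  have "det (keep_rows A' I) > 0" if I: "I \<subset> {0..<n}" for I
  proof (cases "k \<in> I")
    case True
    have "det (keep_rows A' I) = det (keep_rows A I) + t * det (keep_rows A (I \<inter> - {k}))"
      unfolding A'_def keep_rows_add_unit_row_in[OF A True]
      using det_add_unit_row[of "keep_rows A I" n k t] A k by (simp add: keep_rows_keep_rows[OF A])
    moreover have "det (keep_rows A (I \<inter> - {k})) > 0"
      using I by (intro pos) (rule subset_psubset_trans[OF Int_lower1])
    ultimately show ?thesis using pos[OF I] t by (simp add: add_pos_nonneg)
  next
    case False
    then show ?thesis using pos[OF I] by (simp add: A'_def keep_rows_add_unit_row_notin[OF A])
  qed
  then show "almost_P_mat n A'" using P le by (auto simp: almost_P_mat_def)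
qed

lemma almost_P_mat_add_diag:
  assumes A: "A \<in> carrier_mat n n" and P: "almost_P_mat n A" and d: "\<And>i. i < n \<Longrightarrow> d i \<ge> 0"
  shows "almost_P_mat n (A + mat_diag n d)"
    "\<exists>i<n. d i > 0 \<Longrightarrow> det A < det (A + mat_diag n d)"
proof -
  \<comment> \<open>\<open>E m\<close> has only the first \<open>m\<close> diagonal entries raised.
    No step lowers the determinant, and a step with \<open>d m > 0\<close> raises it
    strictly.\<close>
  define E where "E m = A + mat_diag n (\<lambda>i. if i < m then d i else 0)" for m
  have E: "E m \<in> carrier_mat n n" for m by (simp add: E_def)
  have step: "E (Suc m) = E m + mat_diag n (\<lambda>i. if i = m then d m else 0)" for m
    unfolding E_def add_mat_diag_mat_diag[OF A]
    by (intro arg_cong[of _ _ "\<lambda>e. A + mat_diag n e"] ext) auto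
  have E0: "E 0 = A" using A by (intro eq_matI) (auto simp: E_def mat_diag_def)
  have En: "E n = A + mat_diag n d"
    using A by (intro eq_matI) (auto simp: E_def mat_diag_def)
  have "m \<le> n \<Longrightarrow> almost_P_mat n (E m) \<and> det A \<le> det (E m)
      \<and> ((\<exists>i<m. d i > 0) \<longrightarrow> det A < det (E m))" for m
  proof (induction m)
    case 0
    then show ?case using P by (simp add: E0)
  next
    case (Suc m)
    then have m: "m < n" and IH: "almost_P_mat n (E m)" "det A \<le> det (E m)"
      "\<exists>i<m. d i > 0 \<Longrightarrow> det A < det (E m)" by auto
    note * = almost_P_mat_add_unit_row[OF E IH(1) m d[OF m], folded step]
    have "det A < det (E (Suc m))" if "\<exists>i<Suc m. d i > 0"
    proof (cases "d m > 0")
      case True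
      then show ?thesis using * IH(2) by simp
    next
      case False
      then have "\<exists>i<m. d i > 0" using that less_Suc_eq by auto
      then show ?thesis using IH(3) *(3) by simp
    qed
    then show ?case using * IH by simp
  qed
  from this[of n] show "almost_P_mat n (A + mat_diag n d)"
    "\<exists>i<n. d i > 0 \<Longrightarrow> det A < det (A + mat_diag n d)" by (simp_all add: En)
qed

section \<open>Diagonal matrices ordered through their entries\<close>

lemma diagonal_mat_gneqE:
  assumes "D \<in> carrier_mat n n" "D' \<in> carrier_mat n n" "diagonal_mat D" "diagonal_mat D'"
    and "gneq_mat D D'"
  obtains d where "D = D' + mat_diag n d" "\<And>i. i < n \<Longrightarrow> d i \<ge> 0" "\<exists>i<n. d i > 0"
proof
  let ?d = "\<lambda>i. D $$ (i, i) - D' $$ (i, i)"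
  show eq: "D = D' + mat_diag n ?d"
    by (rule eq_matI) (use assms in \<open>auto simp: mat_diag_def diagonal_mat_def\<close>)
  show nonneg: "?d i \<ge> 0" if "i < n" for i
    using assms that by (auto simp: less_eq_mat_def)
  show "\<exists>i<n. ?d i > 0"
  proof (rule ccontr)
    assume "\<not> (\<exists>i<n. ?d i > 0)"
    then have "?d i = 0" if "i < n" for i using nonneg[OF that] that by force
    then have "D' + mat_diag n ?d = D'"
      using assms(2) by (intro eq_matI) (auto simp: mat_diag_def)
    then show False using eq assms(5) by simp
  qed
qed

lemma diagonal_mat_gneq_zeroE:
  assumes "D \<in> carrier_mat n n" "diagonal_mat D" "gneq_mat D (0\<^sub>m n n)"
  obtains d where "D = mat_diag n d" "\<And>i. i < n \<Longrightarrow> d i \<ge> 0" "\<exists>i<n. d i > 0"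
proof -
  have "diagonal_mat (0\<^sub>m n n :: real mat)" by (simp add: diagonal_mat_def)
  then obtain d where d: "D = 0\<^sub>m n n + mat_diag n d" "\<And>i. i < n \<Longrightarrow> d i \<ge> 0" "\<exists>i<n. d i > 0"
    using diagonal_mat_gneqE[OF assms(1) zero_carrier_mat assms(2) _ assms(3)] by metis
  have "D = mat_diag n d" using d(1) by (simp add: mat_diag_def)
  then show ?thesis using that d by blast
qed

lemma mat_diag_gneq:
  fixes d e :: "nat \<Rightarrow> real"
  assumes "\<And>i. i < n \<Longrightarrow> e i \<le> d i" "i < n" "e i < d i"
  shows "gneq_mat (mat_diag n d) (mat_diag n e)"
proof -
  have "mat_diag n d $$ (i, i) \<noteq> mat_diag n e $$ (i, i)"
    using assms(2,3) by (simp add: mat_diag_def)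
  then show ?thesis using assms(1) by (auto simp: less_eq_mat_def mat_diag_def)
qed

lemma mat_diag_gneq_zero:
  fixes d :: "nat \<Rightarrow> real"
  assumes "\<And>i. i < n \<Longrightarrow> 0 \<le> d i" "i < n" "0 < d i"
  shows "gneq_mat (mat_diag n d) (0\<^sub>m n n)"
proof -
  have "mat_diag n (\<lambda>_. 0 :: real) = 0\<^sub>m n n" by (auto simp: mat_diag_def)
  then show ?thesis using mat_diag_gneq[of n "\<lambda>_. 0" d i] assms by simp
qed

lemma diagonal_mat_diag: "diagonal_mat (mat_diag n d)"
  by (simp add: diagonal_mat_def mat_diag_def)

section \<open>The implications between the three conditions\<close>

text \<open>For every \<open>t \<ge> 0\<close> the increment \<open>d i + t\<close> is nonnegative
  with some positive entry, so the shifted determinant exceeds \<open>det M \<ge> 0\<close>. The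
  scalar-shift criterion then yields semipositivity.\<close>

lemma almost_P_mat_imp_nonsingular_M_matrix:
  assumes M: "M \<in> carrier_mat n n" and Z: "Z_matrix M" and P: "almost_P_mat n M"
    and d: "\<And>i. i < n \<Longrightarrow> d i \<ge> 0" "\<exists>i<n. d i > 0"
  shows "nonsingular_M_matrix (M + mat_diag n d)"
proof (rule semipositive_imp_nonsingular_M_matrix[of _ n])
  show "Z_matrix (M + mat_diag n d)" using M Z by (rule Z_matrix_add_diag)
  then show "semipositive_mat (M + mat_diag n d)"
  proof (rule semipositive_if_det_add_scalar_pos[rotated])
    fix t :: real assume "t \<ge> 0"
    then have "det M < det (M + mat_diag n (\<lambda>i. d i + t))"
      using d by (intro almost_P_mat_add_diag(2)[OF M P]) (auto intro: add_pos_nonneg)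
    then show "det (M + mat_diag n d + mat_diag n (\<lambda>_. t)) > 0"
      using P by (simp add: add_mat_diag_mat_diag[OF M] almost_P_mat_def)
  qed simp
qed (use d in auto)

text \<open>Perturbing a single diagonal entry suffices. For a proper subset \<open>I\<close>, an
  entry \<open>k\<close> outside \<open>I\<close> is raised, which leaves the minor on
  \<open>I\<close> as it was; \<open>det M\<close> is the value at 0 of an affine function of
  \<open>t\<close> that is positive for \<open>t > 0\<close>.\<close>

lemma almost_P_mat_if_nonsingular_M_matrix:
  assumes M: "M \<in> carrier_mat n n" and Z: "Z_matrix M"
    and ns: "\<And>k. k < n \<Longrightarrow> (\<And>t. t > 0 \<Longrightarrow>
      nonsingular_M_matrix (M + mat_diag n (\<lambda>i. if i = k then t else 0)))"
  shows "almost_P_mat n M"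
proof (cases "n = 0")
  case True
  then show ?thesis using M by (simp add: almost_P_mat_def)
next
  case False
  let ?A = "\<lambda>k t. M + mat_diag n (\<lambda>i. if i = k then t else 0)"
  have Z': "Z_matrix (?A k t)" for k t using M Z by (rule Z_matrix_add_diag)
  have sp: "semipositive_mat (?A k t)" if "k < n" "t > 0" for k t
    using nonsingular_M_matrix_imp_semipositive[OF add_mat_diag_carrier Z' ns[OF that]] False by simp
  have "det M \<ge> 0"
  proof (rule ccontr)
    let ?c = "det (keep_rows M (- {0}))"
    assume neg: "\<not> det M \<ge> 0"
    have pos: "det M + t * ?c > 0" if "t > 0" for t
      using det_semipositive_pos[OF add_mat_diag_carrier Z' sp[of 0 t]] det_add_unit_row[OF M, of 0 t] that False
      by simp
    then have "?c > 0" using pos[of 1] neg by simp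
    \<comment> \<open>This value of \<open>t\<close> is the zero of the affine function, where
      \<open>pos\<close> demands a positive value.\<close>
    then have "- det M / ?c > 0" using neg by (intro divide_pos_pos) auto
    from pos[OF this] \<open>?c > 0\<close> show False by simp
  qed
  moreover have "det (keep_rows M I) > 0" if I: "I \<subset> {0..<n}" for I
  proof -
    obtain k where k: "k < n" "k \<notin> I" using psubset_imp_ex_mem[OF I] by auto
    have "det (keep_rows (?A k 1) I) > 0"
      using Z_matrix_keep_rows[OF add_mat_diag_carrier Z']
        semipositive_keep_rows[OF add_mat_diag_carrier sp[of k 1]] k
      by (intro det_semipositive_pos[of _ n]) auto
    then show ?thesis by (simp add: keep_rows_add_unit_row_notin[OF M k(2)])
  qed
  ultimately show ?thesis by (simp add: almost_P_mat_def)
qed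

text \<open>Strict growth in entry \<open>k\<close> says that the minor of \<open>M + s I\<close>
  without \<open>k\<close> is positive for every \<open>s \<ge> 0\<close>. The scalar-shift
  criterion thus makes \<open>keep_rows M (- {k})\<close> semipositive, and all minors of
  \<open>M\<close> avoiding \<open>k\<close> are positive. Comparing increments 1 and 2 keeps the
  smaller perturbation nonzero even at \<open>s = 0\<close>.\<close>

lemma almost_P_mat_if_det_strict_mono:
  assumes M: "M \<in> carrier_mat n n" and Z: "Z_matrix M" and det_nonneg: "det M \<ge> 0"
    and mono: "\<And>k s. k < n \<Longrightarrow> s \<ge> 0 \<Longrightarrow>
      det (M + mat_diag n (\<lambda>i. s + (if i = k then 1 else 0)))
        < det (M + mat_diag n (\<lambda>i. s + (if i = k then 2 else 0)))"
  shows "almost_P_mat n M"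
proof -
  have "det (keep_rows M I) > 0" if I: "I \<subset> {0..<n}" for I
  proof -
    obtain k where k: "k < n" "k \<notin> I" using psubset_imp_ex_mem[OF I] by auto
    let ?N = "keep_rows M (- {k})"
    have N: "?N \<in> carrier_mat n n" using M by simp
    have ZN: "Z_matrix ?N" using M Z by (rule Z_matrix_keep_rows)
    have "det (?N + mat_diag n (\<lambda>_. s)) > 0" if s: "s \<ge> 0" for s
    proof -
      let ?L = "keep_rows (M + mat_diag n (\<lambda>_. s)) (- {k})"
      have "det (M + mat_diag n (\<lambda>i. s + (if i = k then t else 0)))
          = det (M + mat_diag n (\<lambda>_. s)) + t * det ?L" for t
        using det_add_unit_row[of "M + mat_diag n (\<lambda>_. s)" n k t] k
        by (simp add: add_mat_diag_mat_diag[OF M])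
      then have L: "det ?L > 0" using mono[OF k(1) s] by simp
      \<comment> \<open>The two matrices differ only at \<open>(k, k)\<close>, where the unit row
        has entry 1 in \<open>?L\<close> and the shift makes it \<open>1 + s\<close>; the
        determinants therefore differ by the factor \<open>1 + s\<close>.\<close>
      have "?N + mat_diag n (\<lambda>_. s) = ?L + mat_diag n (\<lambda>i. if i = k then s else 0)"
        by (rule eq_matI) (use M in \<open>auto simp: keep_rows_def mat_diag_def\<close>)
      then have "det (?N + mat_diag n (\<lambda>_. s)) = det ?L + s * det ?L"
        using det_add_unit_row[of ?L n k s] k by (simp add: keep_rows_keep_rows[of _ n])
      then show ?thesis using L s by (simp add: add_pos_nonneg)
    qed
    then have "semipositive_mat ?N" by (rule semipositive_if_det_add_scalar_pos[OF N ZN])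
    then have "det (keep_rows ?N I) > 0"
      using det_semipositive_pos[of _ n] semipositive_keep_rows[OF N] Z_matrix_keep_rows[OF N ZN] N
      by simp
    moreover have "- {k} \<inter> I = I" using k by auto
    ultimately show ?thesis by (simp add: keep_rows_keep_rows[OF M])
  qed
  then show ?thesis using det_nonneg by (simp add: almost_P_mat_def)
qed

theorem theorem2p3:
  fixes M :: "real mat" and n :: nat
  assumes "M \<in> carrier_mat n n" and "Z_matrix M"
  shows "(almost_nonsingular_M_matrix M \<longleftrightarrow>
           (\<forall>D \<in> carrier_mat n n. diagonal_mat D \<and> gneq_mat D (0\<^sub>m n n) \<longrightarrow>
              nonsingular_M_matrix (M + D))) \<and>
         (almost_nonsingular_M_matrix M \<longleftrightarrow>
           (det M \<ge> 0 \<and>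
            (\<forall>D \<in> carrier_mat n n. \<forall>D' \<in> carrier_mat n n.
               diagonal_mat D \<and> diagonal_mat D' \<and> gneq_mat D D' \<and> gneq_mat D' (0\<^sub>m n n) \<longrightarrow>
               det (M + D) > det (M + D') \<and> det (M + D') > 0)))"
    (is "(?almost \<longleftrightarrow> ?nonsing) \<and> (?almost \<longleftrightarrow> det M \<ge> 0 \<and> ?mono)")
proof -
  note M = assms(1) and Z = assms(2)
  note almost_iff = almost_nonsingular_M_matrix_iff[OF M Z]
  have 12: ?nonsing if ?almost
  proof (intro ballI impI)
    fix D :: "real mat" assume D: "D \<in> carrier_mat n n" "diagonal_mat D \<and> gneq_mat D (0\<^sub>m n n)"
    then obtain d where "D = mat_diag n d" "\<And>i. i < n \<Longrightarrow> d i \<ge> 0" "\<exists>i<n. d i > 0"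
      using diagonal_mat_gneq_zeroE[of D n] by metis
    then show "nonsingular_M_matrix (M + D)"
      using almost_P_mat_imp_nonsingular_M_matrix[OF M Z] that almost_iff by blast
  qed
  have 21: ?almost if ns: ?nonsing
    unfolding almost_iff
  proof (rule almost_P_mat_if_nonsingular_M_matrix[OF M Z])
    fix k and t :: real assume "k < n" "t > 0"
    then have "gneq_mat (mat_diag n (\<lambda>i. if i = k then t else 0)) (0\<^sub>m n n)"
      by (intro mat_diag_gneq_zero[of n _ k]) auto
    then show "nonsingular_M_matrix (M + mat_diag n (\<lambda>i. if i = k then t else 0))"
      using ns diagonal_mat_diag mat_diag_dim by blast
  qed
  have 13: "det M \<ge> 0 \<and> ?mono" if ?almost
  proof (intro conjI ballI impI)
    have P: "almost_P_mat n M" using that almost_iff by simp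
    then show nonneg: "det M \<ge> 0" by (simp add: almost_P_mat_def)
    fix D D' :: "real mat"
    assume D: "D \<in> carrier_mat n n" and D': "D' \<in> carrier_mat n n"
      and *: "diagonal_mat D \<and> diagonal_mat D' \<and> gneq_mat D D' \<and> gneq_mat D' (0\<^sub>m n n)"
    obtain d' where d': "D' = mat_diag n d'" "\<And>i. i < n \<Longrightarrow> d' i \<ge> 0" "\<exists>i<n. d' i > 0"
      using diagonal_mat_gneq_zeroE[of D' n] D' * by metis
    obtain d where d: "D = D' + mat_diag n d" "\<And>i. i < n \<Longrightarrow> d i \<ge> 0" "\<exists>i<n. d i > 0"
      using diagonal_mat_gneqE[OF D D'] * by metis
    have "M + D = M + D' + mat_diag n d"
      unfolding d(1) using M D' by (simp add: assoc_add_mat[of _ n n])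
    \<comment> \<open>\<open>M + D'\<close> again satisfies \<open>almost_P_mat\<close>, so strict
      growth can be applied with it as the starting point.\<close>
    then show "det (M + D) > det (M + D')"
      using almost_P_mat_add_diag(1)[OF M P, of d'] d' d
        almost_P_mat_add_diag(2)[of "M + D'" n d] by simp
    show "det (M + D') > 0"
      using almost_P_mat_add_diag(2)[OF M P, of d'] d' nonneg by simp
  qed
  have 31: ?almost if "det M \<ge> 0" and mono: ?mono
    unfolding almost_iff
  proof (rule almost_P_mat_if_det_strict_mono[OF M Z that(1)])
    fix k and s :: real assume "k < n" "s \<ge> 0"
    then have "gneq_mat (mat_diag n (\<lambda>i. s + (if i = k then 2 else 0)))
        (mat_diag n (\<lambda>i. s + (if i = k then 1 else 0)))"
      "gneq_mat (mat_diag n (\<lambda>i. s + (if i = k then 1 else 0))) (0\<^sub>m n n)"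
      by (intro mat_diag_gneq[of n _ _ k] mat_diag_gneq_zero[of n _ k]; auto)+
    then show "det (M + mat_diag n (\<lambda>i. s + (if i = k then 1 else 0)))
        < det (M + mat_diag n (\<lambda>i. s + (if i = k then 2 else 0)))"
      using mono diagonal_mat_diag mat_diag_dim by blast
  qed
  show ?thesis using 12 21 13 31 by blast
qed

end
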